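(* Let $\varphi$ be the Laplace transform of a random variable $Z>0$, and let $\exp\{-\psi\}$ be the characteristic function of a strictly stable law on $\mathbb{R}$, where $\psi(t)=\lambda|t|^{\alpha}e^{-i\theta\,\mathrm{sgn}(t)}$, $\lambda>0$, $0<\alpha\le 2$, $|\theta|\le\min(\pi\alpha/2,\ \pi-\pi\alpha/2)$. If $\varphi$ is in class-$L$, then the $\varphi$-mixture of this strictly stable law, i.e. the law with characteristic function $t\mapsto\varphi(\psi(t))$, is in class-$L$.
   Context: The Laplace transform $\varphi(v)=E[e^{-vZ}]$ is defined for complex $v$ with $\mathrm{Re}\,v\ge0$. A Laplace transform $\varphi$ (of a law on $[0,\infty)$) is in class-$L$ if for every $0<c<1$ there is a Laplace transform $\varphi_c$ of a probability law on $[0,\infty)$ with $\varphi(s)=\varphi(cs)\,\varphi_c(s)$ for all $s>0$. A law on $\mathbb{R}$ with characteristic function $f$ is in class-$L$ if for every $0<c<1$ there is a characteristic function $f_c$ with $f(t)=f(ct)\,f_c(t)$ for all $t\in\mathbb{R}$. The $\varphi$-mixture of an infinitely divisible law with characteristic function $\omega$ is the law with characteristic function $\varphi\{-\log\omega\}$. *)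

theory Defs
  imports "HOL-Probability.Probability"
begin

definition nonneg_law :: "real measure \<Rightarrow> bool" where
  "nonneg_law N \<longleftrightarrow> real_distribution N \<and> (AE x in N. 0 \<le> x)"

text \<open>Only meaningful for \<^term>\<open>nonneg_law N\<close> and \<^prop>\<open>0 \<le> Re v\<close>.\<close>

definition laplace :: "real measure \<Rightarrow> complex \<Rightarrow> complex" where
  "laplace N v = (CLINT x|N. exp (- (v * complex_of_real x)))"

definition class_L_laplace :: "(complex \<Rightarrow> complex) \<Rightarrow> bool" where
  "class_L_laplace \<phi> \<longleftrightarrow>
     (\<exists>N. nonneg_law N \<and> (\<forall>v. 0 \<le> Re v \<longrightarrow> \<phi> v = laplace N v)) \<and>
     (\<forall>c::real. 0 < c \<and> c < 1 \<longrightarrow>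
        (\<exists>N. nonneg_law N \<and>
          (\<forall>s::real. 0 < s \<longrightarrow>
             \<phi> (complex_of_real s)
               = \<phi> (complex_of_real (c * s)) * laplace N (complex_of_real s))))"

definition class_L_law :: "real measure \<Rightarrow> bool" where
  "class_L_law M \<longleftrightarrow> real_distribution M \<and>
     (\<forall>c::real. 0 < c \<and> c < 1 \<longrightarrow>
        (\<exists>N. real_distribution N \<and> (\<forall>t. char M t = char M (c * t) * char N t)))"

definition infinitely_divisible :: "real measure \<Rightarrow> bool" where
  "infinitely_divisible M \<longleftrightarrow> real_distribution M \<and>
     (\<forall>n::nat. 0 < n \<longrightarrow> (\<exists>N. real_distribution N \<and> (\<forall>t. char M t = char N t ^ n)))"

text \<open>If \<open>X\<close>, \<open>Y\<close> are independent with law \<^term>\<open>S\<close>, then \<open>a X + b Y\<close> has the law of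
  \<open>c X\<close> for some \<open>c > 0\<close>, with no centring. Point masses are not excluded, because the
  parameter range of \<open>stable_exponent\<close> below contains them (\<open>\<alpha> = 1\<close>,
  \<open>\<bar>\<theta>\<bar> = \<pi>/2\<close>).\<close>

definition strictly_stable :: "real measure \<Rightarrow> bool" where
  "strictly_stable S \<longleftrightarrow> real_distribution S \<and>
     (\<forall>a>0. \<forall>b>0. \<exists>c>0.
        distr (S \<Otimes>\<^sub>M S) borel (\<lambda>(x, y). a * x + b * y) = distr S borel (\<lambda>x. c * x))"

definition stable_exponent :: "real \<Rightarrow> real \<Rightarrow> real \<Rightarrow> real \<Rightarrow> complex" where
  "stable_exponent lam \<alpha> \<theta> t =
     complex_of_real (lam * \<bar>t\<bar> powr \<alpha>) * exp (- (\<i> * complex_of_real (\<theta> * sgn t)))"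

text \<open>The function \<open>\<kappa>\<close> is \<open>- log \<omega>\<close> for \<open>\<omega> = char S\<close>, where the logarithm is the
  distinguished one: the unique continuous branch along \<open>\<omega>\<close> that vanishes at \<open>0\<close>
  (not the principal value).\<close>

definition is_mixture :: "(complex \<Rightarrow> complex) \<Rightarrow> real measure \<Rightarrow> real measure \<Rightarrow> bool" where
  "is_mixture \<phi> S M \<longleftrightarrow> infinitely_divisible S \<and> real_distribution M \<and>
     (\<exists>\<kappa>. continuous_on UNIV \<kappa> \<and> \<kappa> 0 = 0 \<and>
          (\<forall>t. char S t = exp (- \<kappa> t)) \<and> (\<forall>t. char M t = \<phi> (\<kappa> t)))"

end

theory Submission imports Defs begin

text \<open>If \<open>Z\<close> has Laplace transform \<open>\<phi>\<close> and \<open>X\<close> is an independent strictly stable variable, then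
  \<open>\<psi>(b t) = b\<^sup>\<alpha> \<psi>(t)\<close> for \<open>b \<ge> 0\<close> shows that \<open>Z\<^bsup>1/\<alpha>\<^esup> X\<close> has characteristic function \<open>\<phi>(\<psi>(t))\<close>. The
  factorisation of this function at \<open>c\<close> is that of \<open>\<phi>\<close> at \<open>c\<^sup>\<alpha>\<close>, evaluated at \<open>\<psi>(t)\<close>, a point of the
  closed right half plane. The class-L condition only factors \<open>\<phi>\<close> on the positive reals, so the
  identity has to be extended: both sides are Laplace transforms of laws on \<open>[0, \<infinity>)\<close>, equality
  at the positive integers gives equal moments under \<open>u = exp (- x)\<close>, and by Weierstrass
  approximation on \<open>[0, 1]\<close> the integrals of \<open>u\<^sup>v\<close> agree for \<open>Re v > 0\<close>; the boundary follows by
  dominated convergence.\<close>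

section \<open>Integrals of continuous functions of \<open>exp (- x)\<close>\<close>

lemma nonneg_lawD:
  assumes "nonneg_law N"
  shows "real_distribution N" "prob_space N" "sets N = sets borel" "AE x in N. 0 \<le> x"
proof -
  show N: "real_distribution N" "AE x in N. 0 \<le> x"
    using assms by (simp_all add: nonneg_law_def)
  interpret real_distribution N by fact
  show "prob_space N" "sets N = sets borel"
    using prob_space_axioms events_eq_borel by simp_all
qed

lemma measurable_nonneg_law:
  "nonneg_law N \<Longrightarrow> f \<in> borel_measurable borel \<Longrightarrow> f \<in> borel_measurable N"
  by (metis measurable_cong_sets nonneg_lawD(3))

text \<open>For almost every \<open>x\<close> the value \<open>exp (- x)\<close> lies in the compact
  interval \<open>{0..1}\<close>, where a continuous \<open>F\<close> is bounded.\<close>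

lemma integrable_exp_neg_comp:
  fixes F :: "real \<Rightarrow> real"
  assumes N: "nonneg_law N" and F: "continuous_on UNIV F"
  shows "integrable N (\<lambda>x. F (exp (- x)))"
proof -
  interpret prob_space N using nonneg_lawD[OF N] by simp
  have "compact (F ` {0..1})"
    by (intro compact_continuous_image continuous_on_subset[OF F]) auto
  then obtain K where "\<forall>y\<in>F ` {0..1}. norm y \<le> K"
    by (auto dest!: compact_imp_bounded simp: bounded_iff)
  then have K: "norm (F u) \<le> K" if "u \<in> {0..1}" for u
    using that by blast
  have "AE x in N. norm (F (exp (- x))) \<le> K"
    using nonneg_lawD(4)[OF N] by eventually_elim (rule K, auto)
  moreover have "(\<lambda>x. F (exp (- x))) \<in> borel_measurable N"
    by (intro measurable_nonneg_law[OF N] borel_measurable_continuous_onI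
        continuous_on_compose2[OF F] continuous_intros) auto
  ultimately show ?thesis by (rule integrable_const_bound)
qed

lemma integral_exp_neg_comp_close:
  fixes F G :: "real \<Rightarrow> real"
  assumes N: "nonneg_law N" and F: "continuous_on UNIV F" and G: "continuous_on UNIV G"
    and e: "\<And>u. u \<in> {0..1} \<Longrightarrow> \<bar>F u - G u\<bar> \<le> e"
  shows "\<bar>(LINT x|N. F (exp (- x))) - (LINT x|N. G (exp (- x)))\<bar> \<le> e"
proof -
  interpret prob_space N using nonneg_lawD[OF N] by simp
  note iF = integrable_exp_neg_comp[OF N F] and iG = integrable_exp_neg_comp[OF N G]
  have "\<bar>(LINT x|N. F (exp (- x))) - (LINT x|N. G (exp (- x)))\<bar>
      = \<bar>LINT x|N. F (exp (- x)) - G (exp (- x))\<bar>"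
    using iF iG by simp
  also have "\<dots> \<le> (LINT x|N. \<bar>F (exp (- x)) - G (exp (- x))\<bar>)"
    by (rule integral_abs_bound)
  also have "\<dots> \<le> (LINT x|N. e)"
  proof (rule integral_mono_AE)
    show "AE x in N. \<bar>F (exp (- x)) - G (exp (- x))\<bar> \<le> e"
      using nonneg_lawD(4)[OF N] by eventually_elim (rule e, auto)
  qed (use iF iG in auto)
  also have "\<dots> = e" using prob_space by simp
  finally show ?thesis .
qed

text \<open>The substitution \<open>u = exp (- x)\<close> reduces the uniqueness question to a
  moment problem on a compact interval, where moments determine the integrals of all continuous
  functions.\<close>

lemma integral_exp_neg_comp_eq:
  fixes F :: "real \<Rightarrow> real"
  assumes A: "nonneg_law A" and B: "nonneg_law B" and F: "continuous_on UNIV F"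
    and moments: "\<And>k::nat. (LINT x|A. exp (- x) ^ k) = (LINT x|B. exp (- x) ^ k)"
  shows "(LINT x|A. F (exp (- x))) = (LINT x|B. F (exp (- x)))"
proof -
  have "\<bar>(LINT x|A. F (exp (- x))) - (LINT x|B. F (exp (- x)))\<bar> \<le> e" if "0 < e" for e
  proof -
    have "continuous_on {0..1} F" by (rule continuous_on_subset[OF F]) auto
    then obtain p where p: "real_polynomial_function p"
      and pF: "\<And>u. u \<in> {0..1} \<Longrightarrow> \<bar>F u - p u\<bar> < e / 2"
      using Stone_Weierstrass_real_polynomial_function[of "{0..1::real}" F "e / 2"] \<open>0 < e\<close>
      by auto
    obtain a n where pa: "p = (\<lambda>u. \<Sum>i\<le>n. a i * u ^ i)"
      using p real_polynomial_function_iff_sum by auto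
    have cp: "continuous_on UNIV p" unfolding pa by (intro continuous_intros)
    have int: "(LINT x|N. p (exp (- x))) = (\<Sum>i\<le>n. a i * (LINT x|N. exp (- x) ^ i))"
      if "nonneg_law N" for N
    proof -
      have "integrable N (\<lambda>x. exp (- x) ^ i)" for i :: nat
        by (rule integrable_exp_neg_comp[OF that, of "\<lambda>u. u ^ i"]) (intro continuous_intros)
      then show ?thesis unfolding pa by simp
    qed
    have "(LINT x|A. p (exp (- x))) = (LINT x|B. p (exp (- x)))"
      using int[OF A] int[OF B] moments by simp
    \<comment> \<open>Replacing \<open>F\<close> by \<open>p\<close> costs at most
      \<open>e / 2\<close> under each of the two laws.\<close>
    moreover note integral_exp_neg_comp_close[OF A F cp less_imp_le[OF pF]]
      integral_exp_neg_comp_close[OF B F cp less_imp_le[OF pF]]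
    ultimately show ?thesis by linarith
  qed
  from field_le_epsilon[of _ 0, simplified, OF this] show ?thesis by simp
qed

section \<open>Uniqueness of the Laplace transform on the closed right half plane\<close>

lemma norm_laplace_kernel_le:
  assumes "0 \<le> Re v" "0 \<le> x"
  shows "norm (exp (- (v * complex_of_real x))) \<le> 1"
  using assms by simp

lemma integrable_laplace_kernel:
  assumes N: "nonneg_law N" and v: "0 \<le> Re v"
  shows "integrable N (\<lambda>x. exp (- (v * complex_of_real x)))"
proof -
  interpret prob_space N using nonneg_lawD[OF N] by simp
  show ?thesis
  proof (rule integrable_const_bound)
    show "AE x in N. norm (exp (- (v * complex_of_real x))) \<le> 1"
      using nonneg_lawD(4)[OF N] by eventually_elim (rule norm_laplace_kernel_le[OF v])
  qed (intro measurable_nonneg_law[OF N], measurable)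
qed

text \<open>This is the power \<open>u\<close> to the \<open>v\<close>, extended by zero. Its
  modulus for \<open>u > 0\<close> is \<open>u powr Re v\<close>, which tends to zero at the origin
  exactly because \<open>Re v\<close> is positive; on the imaginary axis this argument breaks down,
  so the boundary is treated separately.\<close>

lemma continuous_on_cpow_real:
  assumes v: "0 < Re v"
  shows "continuous_on UNIV (\<lambda>u::real. if u \<le> 0 then 0 else exp (v * complex_of_real (ln u)))"
    (is "continuous_on UNIV ?g")
proof -
  have "isCont ?g u" for u
  proof -
    consider "u < 0" | "u = 0" | "0 < u" by linarith
    then show ?thesis
    proof cases
      case 1
      have "\<forall>\<^sub>F w in nhds u. ?g w = 0"
        using eventually_nhds_in_open[of "{..<0}" u] 1 by (auto elim: eventually_mono)
      then show ?thesis by (subst isCont_cong) auto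
    next
      case 3
      have "\<forall>\<^sub>F w in nhds u. ?g w = exp (v * complex_of_real (ln w))"
        using eventually_nhds_in_open[of "{0<..}" u] 3 by (auto elim: eventually_mono)
      moreover have "isCont (\<lambda>w. exp (v * complex_of_real (ln w))) u"
        using 3 by (intro continuous_intros) auto
      ultimately show ?thesis by (subst isCont_cong)
    next
      case 2
      have "((\<lambda>w. \<bar>w\<bar> powr Re v) \<longlongrightarrow> \<bar>0\<bar> powr Re v) (at (0::real))"
        using v by (intro tendsto_powr' tendsto_intros) auto
      then have "((\<lambda>w. \<bar>w\<bar> powr Re v) \<longlongrightarrow> 0) (at (0::real))" by simp
      moreover have "norm (?g w) \<le> \<bar>w\<bar> powr Re v" for w
        by (auto simp: powr_def)
      ultimately have "(?g \<longlongrightarrow> 0) (at 0)"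
        by (intro Lim_null_comparison[of ?g]) auto
      then show ?thesis using 2 by (simp add: isCont_def)
    qed
  qed
  then show ?thesis by (simp add: continuous_on_eq_continuous_at)
qed

lemma laplace_eq_open_half_plane:
  assumes A: "nonneg_law A" and B: "nonneg_law B"
    and eq: "\<And>s::real. 0 < s \<Longrightarrow> laplace A (complex_of_real s) = laplace B (complex_of_real s)"
    and v: "0 < Re v"
  shows "laplace A v = laplace B v"
proof -
  interpret A: prob_space A using nonneg_lawD[OF A] by simp
  interpret B: prob_space B using nonneg_lawD[OF B] by simp
  \<comment> \<open>The Laplace kernel becomes a continuous function of \<open>exp (- x)\<close>;
    splitting it into real and imaginary parts fits the real-valued approximation result.\<close>
  define g where "g u = (if u \<le> 0 then 0 else exp (v * complex_of_real (ln u)))" for u :: real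
  have g: "continuous_on UNIV g"
    unfolding g_def using continuous_on_cpow_real[OF v] .
  have g_exp: "exp (- (v * complex_of_real x)) = g (exp (- x))" for x
    by (simp add: g_def)
  have moments: "(LINT x|A. exp (- x) ^ k) = (LINT x|B. exp (- x) ^ k)" for k :: nat
  \<comment> \<open>The moment of order \<open>k\<close> is the transform at \<open>s = k\<close>.
    As \<open>eq\<close> covers only \<open>s > 0\<close>, order zero is settled by total mass
    one.\<close>
  proof (cases "k = 0")
    case True
    then show ?thesis by (simp add: A.prob_space B.prob_space)
  next
    case False
    have "complex_of_real (LINT x|N. exp (- x) ^ k) = laplace N (complex_of_real (real k))" for N
      unfolding laplace_def integral_complex_of_real[symmetric]
      by (intro Bochner_Integration.integral_cong refl)
        (simp flip: exp_of_nat_mult exp_of_real)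
    then show ?thesis using eq[of "real k"] False by (metis of_nat_0_less_iff of_real_eq_iff neq0_conv)
  qed
  have ReIm: "Re (laplace N v) = (LINT x|N. Re (g (exp (- x))))"
    "Im (laplace N v) = (LINT x|N. Im (g (exp (- x))))" if "nonneg_law N" for N
    using integrable_laplace_kernel[OF that less_imp_le[OF v]]
    unfolding laplace_def g_exp by simp_all
  show ?thesis
  proof (rule complex_eqI)
    show "Re (laplace A v) = Re (laplace B v)"
      unfolding ReIm[OF A] ReIm[OF B]
      by (rule integral_exp_neg_comp_eq[OF A B _ moments]) (intro continuous_intros g)
    show "Im (laplace A v) = Im (laplace B v)"
      unfolding ReIm[OF A] ReIm[OF B]
      by (rule integral_exp_neg_comp_eq[OF A B _ moments]) (intro continuous_intros g)
  qed
qed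

text \<open>The shifted points have positive real part, and on \<open>x \<ge> 0\<close> all the
  kernels are dominated by the constant 1.\<close>

lemma laplace_tendsto_boundary:
  assumes N: "nonneg_law N" and v: "0 \<le> Re v"
  shows "(\<lambda>n. laplace N (v + complex_of_real (1 / Suc n))) \<longlonglongrightarrow> laplace N v"
proof -
  interpret prob_space N using nonneg_lawD[OF N] by simp
  have 0: "(\<lambda>n. v + complex_of_real (1 / real (Suc n))) \<longlonglongrightarrow> v + complex_of_real 0"
    by (intro tendsto_intros LIMSEQ_Suc[OF lim_1_over_n])
  show ?thesis unfolding laplace_def
  proof (rule integral_dominated_convergence[where w = "\<lambda>_. 1"])
    show "AE x in N. (\<lambda>n. exp (- ((v + complex_of_real (1 / Suc n)) * complex_of_real x)))
        \<longlonglongrightarrow> exp (- (v * complex_of_real x))"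
      using 0 by (intro AE_I2 tendsto_intros) simp
    show "AE x in N. norm (exp (- ((v + complex_of_real (1 / Suc n)) * complex_of_real x))) \<le> 1" for n
      using nonneg_lawD(4)[OF N]
      by eventually_elim (rule norm_laplace_kernel_le, use v in auto)
  qed (auto intro!: measurable_nonneg_law[OF N])
qed

lemma laplace_eq_half_plane:
  assumes A: "nonneg_law A" and B: "nonneg_law B"
    and eq: "\<And>s::real. 0 < s \<Longrightarrow> laplace A (complex_of_real s) = laplace B (complex_of_real s)"
    and v: "0 \<le> Re v"
  shows "laplace A v = laplace B v"
proof -
  have "laplace A (v + complex_of_real (1 / Suc n)) = laplace B (v + complex_of_real (1 / Suc n))" for n
    by (rule laplace_eq_open_half_plane[OF A B eq]) (use v in \<open>auto intro: add_nonneg_pos\<close>)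
  then show ?thesis
    using laplace_tendsto_boundary[OF A v] laplace_tendsto_boundary[OF B v] LIMSEQ_unique by simp
qed

section \<open>Products of Laplace transforms\<close>

lemma integral_pair_prob:
  fixes f :: "'a \<times> 'b \<Rightarrow> complex"
  assumes "prob_space A" "prob_space B" "f \<in> borel_measurable (A \<Otimes>\<^sub>M B)"
    and "AE z in A \<Otimes>\<^sub>M B. norm (f z) \<le> K"
  shows "(LINT z|(A \<Otimes>\<^sub>M B). f z) = (LINT x|A. LINT y|B. f (x, y))"
proof -
  interpret A: prob_space A by fact
  interpret B: prob_space B by fact
  interpret pair_prob_space A B ..
  have "integrable (A \<Otimes>\<^sub>M B) f"
    using assms(4,3) by (rule P.integrable_const_bound)
  then show ?thesis by (rule integral_fst'[symmetric])
qed

text \<open>\<open>C\<close> is the law of \<open>c * X + Y\<close> for independent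
  \<open>X\<close>, \<open>Y\<close> with laws \<open>A\<close>, \<open>B\<close>. It turns the
  right side of the class-L factorisation into a single Laplace transform, to which uniqueness can
  be applied.\<close>

lemma laplace_mult:
  assumes A: "nonneg_law A" and B: "nonneg_law B" and c: "0 \<le> c"
  obtains C where "nonneg_law C"
    "\<And>v. 0 \<le> Re v \<Longrightarrow> laplace C v = laplace A (complex_of_real c * v) * laplace B v"
proof
  interpret A: prob_space A using nonneg_lawD[OF A] by simp
  interpret B: prob_space B using nonneg_lawD[OF B] by simp
  interpret pair_prob_space A B ..
  define C where "C = distr (A \<Otimes>\<^sub>M B) borel (\<lambda>z. c * fst z + snd z)"
  note [measurable_cong] = nonneg_lawD(3)[OF A] nonneg_lawD(3)[OF B]
  have nonneg: "AE z in A \<Otimes>\<^sub>M B. 0 \<le> c * fst z + snd z"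
  proof (rule AE_pair_measure)
    show "AE x in A. AE y in B. 0 \<le> c * fst (x, y) + snd (x, y)"
      using nonneg_lawD(4)[OF A]
    proof eventually_elim
      case (elim x)
      show ?case using nonneg_lawD(4)[OF B] by eventually_elim (use c elim in auto)
    qed
  qed measurable
  show "nonneg_law C"
    unfolding nonneg_law_def
  proof
    show "real_distribution C"
      unfolding C_def by (intro real_distribution_distr) measurable
    show "AE x in C. 0 \<le> x"
      unfolding C_def using nonneg by (subst AE_distr_iff) auto
  qed
  fix v :: complex assume v: "0 \<le> Re v"
  have "laplace C v = (LINT z|(A \<Otimes>\<^sub>M B). exp (- (v * complex_of_real (c * fst z + snd z))))"
    unfolding laplace_def C_def by (rule integral_distr) measurable
  also have "\<dots> = (LINT x|A. LINT y|B. exp (- (v * complex_of_real (c * x + y))))"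
  proof (subst integral_pair_prob[where K = 1])
    \<comment> \<open>The kernel is bounded by 1 only where its argument is nonnegative, hence only
      almost everywhere.\<close>
    show "AE z in A \<Otimes>\<^sub>M B. norm (exp (- (v * complex_of_real (c * fst z + snd z)))) \<le> 1"
      using nonneg by eventually_elim (rule norm_laplace_kernel_le[OF v])
  qed (use A.prob_space_axioms B.prob_space_axioms in auto)
  also have "\<dots> = laplace A (complex_of_real c * v) * laplace B v"
  proof -
    have "exp (- (v * complex_of_real (c * x + y)))
        = exp (- (complex_of_real c * v * complex_of_real x)) * exp (- (v * complex_of_real y))" for x y
      by (simp add: algebra_simps flip: exp_add)
    then show ?thesis unfolding laplace_def by simp
  qed
  finally show "laplace C v = laplace A (complex_of_real c * v) * laplace B v" .
qed

section \<open>The stable exponent and its mixtures\<close>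

lemma stable_exponent_0 [simp]: "stable_exponent lam \<alpha> \<theta> 0 = 0"
  by (simp add: stable_exponent_def)

text \<open>A nonnegative factor does not change the sign of \<open>t\<close> unless it is zero, and
  then both sides vanish because \<open>0 powr \<alpha> = 0\<close>.\<close>

lemma stable_exponent_scale:
  assumes "0 \<le> b"
  shows "stable_exponent lam \<alpha> \<theta> (b * t) = complex_of_real (b powr \<alpha>) * stable_exponent lam \<alpha> \<theta> t"
  using assms by (cases "b = 0") (auto simp: stable_exponent_def powr_mult abs_mult sgn_mult)

text \<open>The phase jumps at the origin with \<open>sgn\<close>, but the modulus tends to zero
  there.\<close>

lemma continuous_on_stable_exponent:
  assumes \<alpha>: "0 < \<alpha>"
  shows "continuous_on UNIV (stable_exponent lam \<alpha> \<theta>)"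
proof -
  let ?f = "stable_exponent lam \<alpha> \<theta>"
  have "isCont ?f t" for t
  proof -
    consider "t = 0" | "t \<noteq> 0" by linarith
    then show ?thesis
    proof cases
      case 1
      have "((\<lambda>w. \<bar>lam\<bar> * \<bar>w\<bar> powr \<alpha>) \<longlongrightarrow> \<bar>lam\<bar> * \<bar>0\<bar> powr \<alpha>) (at (0::real))"
        using \<alpha> by (intro tendsto_mult tendsto_const tendsto_powr' tendsto_intros) auto
      then have "((\<lambda>w. \<bar>lam\<bar> * \<bar>w\<bar> powr \<alpha>) \<longlongrightarrow> 0) (at (0::real))" by simp
      moreover have "norm (?f w) \<le> \<bar>lam\<bar> * \<bar>w\<bar> powr \<alpha>" for w
        by (simp add: stable_exponent_def norm_mult abs_mult)
      ultimately have "(?f \<longlongrightarrow> 0) (at 0)"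
        by (intro Lim_null_comparison[of ?f]) auto
      then show ?thesis using 1 by (simp add: isCont_def)
    next
      case 2
      then show ?thesis
        unfolding stable_exponent_def by (intro continuous_intros) auto
    qed
  qed
  then show ?thesis by (simp add: continuous_on_eq_continuous_at)
qed

text \<open>The two bounds on the angle add up to \<open>pi\<close>, so the smaller one is at most
  \<open>pi / 2\<close> and the cosine of the phase is nonnegative.\<close>

lemma Re_stable_exponent_nonneg:
  assumes "0 < lam" "\<bar>\<theta>\<bar> \<le> min (pi * \<alpha> / 2) (pi - pi * \<alpha> / 2)"
  shows "0 \<le> Re (stable_exponent lam \<alpha> \<theta> t)"
proof -
  have "\<bar>\<theta>\<bar> \<le> pi / 2" using assms(2) by auto
  then have "0 \<le> cos (\<theta> * sgn t)"
    by (intro cos_ge_zero) (auto simp: sgn_if split: if_splits)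
  then show ?thesis using assms(1)
    by (simp add: stable_exponent_def Re_exp)
qed

lemma infinitely_divisible_stable:
  assumes S: "real_distribution S" and \<alpha>: "0 < \<alpha>"
    and char: "\<And>t. char S t = exp (- stable_exponent lam \<alpha> \<theta> t)"
  shows "infinitely_divisible S"
  unfolding infinitely_divisible_def
proof (intro conjI S allI impI)
  fix n :: nat assume n: "0 < n"
  interpret S: real_distribution S by fact
  \<comment> \<open>Scaling by \<open>b\<close> divides the exponent by \<open>n\<close>, so the
    \<open>n\<close>-th convolution root is a rescaled copy of \<open>S\<close>.\<close>
  define b where "b = (1 / real n) powr (1 / \<alpha>)"
  have b: "0 \<le> b" "b powr \<alpha> = 1 / real n"
    using \<alpha> n by (auto simp: b_def powr_powr)
  let ?N = "distr S borel (\<lambda>x. b * x)"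
  have "char ?N t = exp (- (stable_exponent lam \<alpha> \<theta> t / of_nat n))" for t
  proof -
    have "char ?N t = char S (b * t)"
      unfolding char_def by (subst integral_distr) (auto simp: ac_simps)
    then show ?thesis by (simp add: char stable_exponent_scale b)
  qed
  then have "char S t = char ?N t ^ n" for t
    using n by (simp add: char flip: exp_of_nat_mult)
  moreover have "real_distribution ?N"
    by (rule S.real_distribution_distr) measurable
  ultimately show "\<exists>N. real_distribution N \<and> (\<forall>t. char S t = char N t ^ n)" by blast
qed

text \<open>Conditioning on the mixing variable and using homogeneity of the exponent gives the
  formula. It serves twice: for the mixture itself and for its class-L cofactor.\<close>

lemma stable_mixture_exists:
  assumes N: "nonneg_law N" and S: "real_distribution S" and \<alpha>: "0 < \<alpha>"
    and char: "\<And>t. char S t = exp (- stable_exponent lam \<alpha> \<theta> t)"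
  obtains M where "real_distribution M" "\<And>t. char M t = laplace N (stable_exponent lam \<alpha> \<theta> t)"
proof
  interpret N: prob_space N using nonneg_lawD[OF N] by simp
  interpret S: real_distribution S by fact
  interpret pair_prob_space N S ..
  define M where "M = distr (N \<Otimes>\<^sub>M S) borel (\<lambda>z. fst z powr (1 / \<alpha>) * snd z)"
  note [measurable_cong] = nonneg_lawD(3)[OF N]
  show "real_distribution M"
    unfolding M_def by (intro real_distribution_distr) measurable
  fix t
  have "char M t = (LINT z|(N \<Otimes>\<^sub>M S). iexp (t * (fst z powr (1 / \<alpha>) * snd z)))"
    unfolding char_def M_def by (rule integral_distr) measurable
  also have "\<dots> = (LINT x|N. LINT y|S. iexp (t * (x powr (1 / \<alpha>) * y)))"
    by (subst integral_pair_prob[where K = 1])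
      (use N.prob_space_axioms S.prob_space_axioms in auto)
  also have "\<dots> = (LINT x|N. char S (x powr (1 / \<alpha>) * t))"
    unfolding char_def by (simp add: ac_simps)
  also have "\<dots> = laplace N (stable_exponent lam \<alpha> \<theta> t)"
    unfolding laplace_def
  proof (rule integral_cong_AE)
    \<comment> \<open>Raising \<open>x powr (1 / \<alpha>)\<close> to the power
      \<open>\<alpha>\<close> returns \<open>x\<close> only for \<open>x \<ge> 0\<close>, hence the
      almost-everywhere form.\<close>
    show "AE x in N. char S (x powr (1 / \<alpha>) * t)
        = exp (- (stable_exponent lam \<alpha> \<theta> t * complex_of_real x))"
      using nonneg_lawD(4)[OF N]
      by eventually_elim (use \<alpha> in \<open>simp add: char stable_exponent_scale powr_powr, simp add: mult.commute\<close>)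
  qed measurable
  finally show "char M t = laplace N (stable_exponent lam \<alpha> \<theta> t)" .
qed

theorem mainTheorem5:
  fixes \<Omega> :: "'w measure" and Z :: "'w \<Rightarrow> real" and \<phi> :: "complex \<Rightarrow> complex"
    and S :: "real measure" and lam \<alpha> \<theta> :: real
  assumes "prob_space \<Omega>"
    and "Z \<in> borel_measurable \<Omega>"
    and "AE w in \<Omega>. 0 < Z w"
    and "\<And>v. 0 \<le> Re v \<Longrightarrow> \<phi> v = (CLINT w|\<Omega>. exp (- (v * complex_of_real (Z w))))"
    and "0 < lam" and "0 < \<alpha>" and "\<alpha> \<le> 2"
    and "\<bar>\<theta>\<bar> \<le> min (pi * \<alpha> / 2) (pi - pi * \<alpha> / 2)"
    and "strictly_stable S"
    and "\<And>t. char S t = exp (- stable_exponent lam \<alpha> \<theta> t)"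
    and "class_L_laplace \<phi>"
  shows "\<exists>M. is_mixture \<phi> S M \<and>
             (\<forall>t. char M t = \<phi> (stable_exponent lam \<alpha> \<theta> t)) \<and>
             class_L_law M"
proof -
  let ?\<psi> = "stable_exponent lam \<alpha> \<theta>"
  have S: "real_distribution S" using assms(9) by (simp add: strictly_stable_def)
  have Re_\<psi>: "0 \<le> Re (?\<psi> t)" for t
    using assms(5,8) by (rule Re_stable_exponent_nonneg)
  obtain N where N: "nonneg_law N" and \<phi>: "\<And>v. 0 \<le> Re v \<Longrightarrow> \<phi> v = laplace N v"
    using assms(11) unfolding class_L_laplace_def by auto
  obtain M where M: "real_distribution M" and "\<And>t. char M t = laplace N (?\<psi> t)"
    using stable_mixture_exists[OF N S assms(6,10)] by blast
  then have char_M: "char M t = \<phi> (?\<psi> t)" for t using \<phi>[OF Re_\<psi>] by simp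
  have "\<exists>M'. real_distribution M' \<and> (\<forall>t. char M t = char M (c * t) * char M' t)"
    if c: "0 < c" "c < 1" for c
  proof -
    \<comment> \<open>By homogeneity, scaling \<open>t\<close> by \<open>c\<close> multiplies the
      exponent by \<open>d\<close>, so the factorisation of \<open>\<phi>\<close> is needed at
      \<open>d\<close>.\<close>
    define d where "d = c powr \<alpha>"
    have d: "0 < d" "d < 1"
      using c \<open>0 < \<alpha>\<close> powr_less_mono2[of \<alpha> c 1] by (auto simp: d_def)
    then obtain N' where N': "nonneg_law N'" and fac: "\<And>s::real. 0 < s \<Longrightarrow>
        \<phi> (complex_of_real s) = \<phi> (complex_of_real (d * s)) * laplace N' (complex_of_real s)"
      using assms(11) unfolding class_L_laplace_def by blast
    obtain C where C: "nonneg_law C"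
      and C_eq: "\<And>v. 0 \<le> Re v \<Longrightarrow> laplace C v = laplace N (complex_of_real d * v) * laplace N' v"
      using laplace_mult[OF N N'] d by (metis less_imp_le)
    have "laplace N (complex_of_real s) = laplace C (complex_of_real s)" if "0 < s" for s
      using fac[OF that] \<phi> C_eq that d by simp
    \<comment> \<open>Agreement of the transforms of \<open>N\<close> and \<open>C\<close> on the
      positive reals extends to the closed half plane, which contains the values of the
      exponent.\<close>
    then have fac': "\<phi> v = \<phi> (complex_of_real d * v) * laplace N' v" if "0 \<le> Re v" for v
      using laplace_eq_half_plane[OF N C _ that] C_eq[OF that] \<phi> that d by simp
    \<comment> \<open>The cofactor is the mixture of the same stable law with mixing law
      \<open>N'\<close>.\<close>
    obtain M' where M': "real_distribution M'" and char_M': "\<And>t. char M' t = laplace N' (?\<psi> t)"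
      using stable_mixture_exists[OF N' S assms(6,10)] by blast
    have "char M t = char M (c * t) * char M' t" for t
      using fac'[OF Re_\<psi>] c by (simp add: char_M char_M' stable_exponent_scale d_def)
    with M' show ?thesis by blast
  qed
  then have "class_L_law M" using M by (simp add: class_L_law_def)
  \<comment> \<open>The exponent is itself the distinguished branch: it is continuous and vanishes
    at the origin.\<close>
  moreover have "is_mixture \<phi> S M"
    unfolding is_mixture_def
    using infinitely_divisible_stable[OF S assms(6,10)] M assms(10) char_M
      continuous_on_stable_exponent[OF assms(6)] stable_exponent_0 by blast
  ultimately show ?thesis using char_M by blast
qed

end
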